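(* A ring $R$ has Property K if and only if there is a ring $S$ such that $R\cong \mathbb M_2(S)$ and $1_S$ is a sum of two units of $S$ (that is, $1_S\in \mathrm U(S)+\mathrm U(S)$).
   Context: Rings are associative with identity, not necessarily commutative; the zero ring is allowed. $\mathrm U(S)$ is the group of units of $S$ and $\mathbb M_2(S)$ is the ring of $2\times 2$ matrices over $S$. A ring $R$ has Property K if there exist idempotents $e,e'\in R$ such that the commutator $ee'-e'e$ is a unit of $R$. *)

theory Defs
  imports "HOL-Algebra.QuotRing"
begin

text \<open>
  Rings are the carrier-based rings of the library: the locale \<^locale>\<open>ring\<close> assumes neither
  commutativity nor \<open>\<one> \<noteq> \<zero>\<close>, so the zero ring is included, and \<^const>\<open>Units\<close> is the group of
  two-sided units.
\<close>

definition property_K :: "('a, 'm) ring_scheme \<Rightarrow> bool" where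
  "property_K R \<longleftrightarrow>
     (\<exists>e \<in> carrier R. \<exists>e' \<in> carrier R.
        e \<otimes>\<^bsub>R\<^esub> e = e \<and> e' \<otimes>\<^bsub>R\<^esub> e' = e' \<and>
        e \<otimes>\<^bsub>R\<^esub> e' \<ominus>\<^bsub>R\<^esub> e' \<otimes>\<^bsub>R\<^esub> e \<in> Units R)"

text \<open>
  A matrix is a function from index pairs to entries that is extensional, i.e. \<^const>\<open>undefined\<close>
  outside the index set, so that equality of matrices is equality of their entries.
\<close>

definition matrix_ring :: "nat \<Rightarrow> ('a, 'm) ring_scheme \<Rightarrow> (nat \<times> nat \<Rightarrow> 'a) ring" where
  "matrix_ring n S =
     \<lparr>carrier = {..<n} \<times> {..<n} \<rightarrow>\<^sub>E carrier S,
      mult = (\<lambda>A B. \<lambda>(i, j) \<in> {..<n} \<times> {..<n}. \<Oplus>\<^bsub>S\<^esub>k \<in> {..<n}. A (i, k) \<otimes>\<^bsub>S\<^esub> B (k, j)),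
      one = (\<lambda>(i, j) \<in> {..<n} \<times> {..<n}. if i = j then \<one>\<^bsub>S\<^esub> else \<zero>\<^bsub>S\<^esub>),
      zero = (\<lambda>(i, j) \<in> {..<n} \<times> {..<n}. \<zero>\<^bsub>S\<^esub>),
      add = (\<lambda>A B. \<lambda>(i, j) \<in> {..<n} \<times> {..<n}. A (i, j) \<oplus>\<^bsub>S\<^esub> B (i, j))\<rparr>"

end

theory Submission
  imports Defs
begin

text \<open>
  If \<open>c = e e' - e' e\<close> is a unit, then \<open>e c = c (1 - e)\<close>, so \<open>c\<close> conjugates \<open>1 - e\<close> to \<open>e\<close> and \<open>R\<close> is
  the ring of \<open>2 \<times> 2\<close> matrices over the corner \<open>S = e R e\<close>. With \<open>a = e e' e\<close> one has
  \<open>e c\<^sup>2 = - a (e - a)\<close>, which is a unit of \<open>S\<close>; hence \<open>a\<close> and \<open>e - a\<close> are units of \<open>S\<close> with sum \<open>e\<close>.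
  Conversely, if \<open>1 = u + v\<close> with units \<open>u, v\<close>, then the diagonal idempotent \<open>(1, 0; 0, 0)\<close> and the
  idempotent \<open>(u, u; v, v)\<close>, the product of a column and a row, have the commutator \<open>(0, u; -v, 0)\<close>.
\<close>

section \<open>Corner rings\<close>

text \<open>For an idempotent \<open>e\<close> this is the Peirce corner \<open>eRe\<close>.
  Describing its elements as those fixed by \<open>e\<close> on both sides turns membership into two
  equations that rewriting can use.\<close>

definition corner :: "('a, 'm) ring_scheme \<Rightarrow> 'a \<Rightarrow> 'a ring" where
  "corner R e =
     \<lparr>carrier = {x \<in> carrier R. e \<otimes>\<^bsub>R\<^esub> x = x \<and> x \<otimes>\<^bsub>R\<^esub> e = x},
      mult = mult R, one = e, zero = \<zero>\<^bsub>R\<^esub>, add = add R\<rparr>"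

lemma corner_simps [simp]:
  "mult (corner R e) = mult R" "one (corner R e) = e"
  "zero (corner R e) = \<zero>\<^bsub>R\<^esub>" "add (corner R e) = add R"
  by (simp_all add: corner_def)

lemma carrier_corner:
  "x \<in> carrier (corner R e) \<longleftrightarrow> x \<in> carrier R \<and> e \<otimes>\<^bsub>R\<^esub> x = x \<and> x \<otimes>\<^bsub>R\<^esub> e = x"
  by (simp add: corner_def)

context ring
begin

lemma ring_corner:
  assumes "e \<in> carrier R" "e \<otimes> e = e"
  shows "ring (corner R e)"
proof (intro ringI abelian_groupI monoidI)
  fix x assume x: "x \<in> carrier (corner R e)"
  then show "\<exists>y\<in>carrier (corner R e). y \<oplus>\<^bsub>corner R e\<^esub> x = \<zero>\<^bsub>corner R e\<^esub>"
    using assms by (intro bexI[of _ "\<ominus> x"]) (auto simp: carrier_corner r_minus l_minus l_neg)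
next
  fix x y assume "x \<in> carrier (corner R e)" "y \<in> carrier (corner R e)"
  then show "x \<otimes>\<^bsub>corner R e\<^esub> y \<in> carrier (corner R e)"
    using assms by (simp add: carrier_corner) (metis m_assoc)
qed (use assms in \<open>auto simp: carrier_corner l_distr r_distr a_ac m_assoc\<close>)

text \<open>Products in a matrix ring over the corner are sums formed in the corner; this moves them
  to R, where the distributive laws for \<open>finsum\<close> apply.\<close>

lemma finsum_corner:
  assumes "e \<in> carrier R" "e \<otimes> e = e" "finite A" "f \<in> A \<rightarrow> carrier (corner R e)"
  shows "finsum (corner R e) f A = finsum R f A"
proof -
  interpret C: ring "corner R e"
    using assms by (intro ring_corner)
  show ?thesis
    using assms(3,4)
  proof (induction A rule: finite_induct)
    case (insert x A)
    then have "f x \<in> carrier R" "f \<in> A \<rightarrow> carrier R"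
      by (auto simp: carrier_corner)
    with insert show ?case
      by simp
  qed (simp add: C.finsum_empty[simplified])
qed

section \<open>Matrix rings over corners\<close>

lemma finsum_delta:
  assumes "finite A" "i \<in> A" "f i \<in> carrier R"
    and "\<And>j. j \<in> A \<Longrightarrow> j \<noteq> i \<Longrightarrow> f j = \<zero>"
  shows "finsum R f A = f i"
proof -
  have closed: "f \<in> A \<rightarrow> carrier R"
    using assms(3,4) by force
  have "finsum R f A = (\<Oplus>j\<in>A. if i = j then f j else \<zero>)"
    using assms(4) closed by (intro finsum_cong') auto
  also have "\<dots> = f i"
    using assms(1,2) closed by (intro finsum_singleton)
  finally show ?thesis .
qed

text \<open>The elements \<open>q i \<otimes> p j\<close> form a full system of matrix units, with
  the corner as coefficient ring. The isomorphism sends x to the matrix of all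
  \<open>p i \<otimes> x \<otimes> q j\<close>; its inverse sends A to the double sum of
  \<open>q k \<otimes> A (k, l) \<otimes> p l\<close>.\<close>

lemma iso_matrix_ring_corner:
  fixes p q :: "nat \<Rightarrow> 'a"
  assumes e: "e \<in> carrier R" "e \<otimes> e = e"
    and p: "p \<in> {..<n} \<rightarrow> carrier R" and q: "q \<in> {..<n} \<rightarrow> carrier R"
    and ep: "\<And>i. i < n \<Longrightarrow> e \<otimes> p i = p i" and qe: "\<And>i. i < n \<Longrightarrow> q i \<otimes> e = q i"
    and pq: "\<And>i j. i < n \<Longrightarrow> j < n \<Longrightarrow> p i \<otimes> q j = (if i = j then e else \<zero>)"
    and qp: "(\<Oplus>k\<in>{..<n}. q k \<otimes> p k) = \<one>"
  shows "R \<simeq> matrix_ring n (corner R e)"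
proof -
  let ?I = "{..<n} \<times> {..<n}"
  let ?M = "matrix_ring n (corner R e)"
  define \<phi> where "\<phi> x = (\<lambda>(i, j) \<in> ?I. p i \<otimes> x \<otimes> q j)" for x
  have pc [simp]: "p i \<in> carrier R" and qc [simp]: "q i \<in> carrier R" if "i < n" for i
    using that p q by auto
  have entry: "p i \<otimes> x \<otimes> q j \<in> carrier (corner R e)" if "x \<in> carrier R" "i < n" "j < n" for x i j
    using that e by (simp add: carrier_corner m_assoc qe) (simp add: m_assoc[symmetric] ep)
  have \<phi>_closed: "\<phi> x \<in> carrier ?M" if "x \<in> carrier R" for x
    using that entry by (auto simp: \<phi>_def matrix_ring_def)
  \<comment> \<open>Insert 1 as the sum of the \<open>q k \<otimes> p k\<close> between x and y.
    This gives multiplicativity of \<open>\<phi>\<close> and, with 1 inserted on both sides of x,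
    its injectivity.\<close>
  have expand: "(\<Oplus>k\<in>{..<n}. (x \<otimes> q k) \<otimes> (p k \<otimes> y)) = x \<otimes> y" if "x \<in> carrier R" "y \<in> carrier R" for x y
  proof -
    have "x \<otimes> y = x \<otimes> ((\<Oplus>k\<in>{..<n}. q k \<otimes> p k) \<otimes> y)"
      using that qp by simp
    also have "\<dots> = (\<Oplus>k\<in>{..<n}. x \<otimes> (q k \<otimes> p k \<otimes> y))"
      using that by (subst finsum_ldistr) (auto simp: finsum_rdistr Pi_def)
    also have "\<dots> = (\<Oplus>k\<in>{..<n}. (x \<otimes> q k) \<otimes> (p k \<otimes> y))"
      using that by (intro finsum_cong') (auto simp: m_assoc)
    finally show ?thesis by simp
  qed
  have "\<phi> \<in> ring_iso R ?M"
  proof (rule ring_iso_memI)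
    fix x y assume xy: "x \<in> carrier R" "y \<in> carrier R"
    have "p i \<otimes> (x \<otimes> y) \<otimes> q j =
        (\<Oplus>\<^bsub>corner R e\<^esub>k\<in>{..<n}. \<phi> x (i, k) \<otimes> \<phi> y (k, j))" if ij: "i < n" "j < n" for i j
    proof -
      have "p i \<otimes> (x \<otimes> y) \<otimes> q j = (p i \<otimes> x) \<otimes> (y \<otimes> q j)"
        using xy ij by (simp add: m_assoc)
      also have "\<dots> = (\<Oplus>k\<in>{..<n}. (p i \<otimes> x \<otimes> q k) \<otimes> (p k \<otimes> (y \<otimes> q j)))"
        using xy ij by (simp add: expand)
      also have "\<dots> = (\<Oplus>k\<in>{..<n}. \<phi> x (i, k) \<otimes> \<phi> y (k, j))"
        using xy ij by (intro finsum_cong') (auto simp: \<phi>_def m_assoc)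
      also have "\<dots> = (\<Oplus>\<^bsub>corner R e\<^esub>k\<in>{..<n}. \<phi> x (i, k) \<otimes> \<phi> y (k, j))"
      proof (rule finsum_corner[OF e, symmetric])
        interpret C: ring "corner R e"
          using e by (rule ring_corner)
        show "(\<lambda>k. \<phi> x (i, k) \<otimes> \<phi> y (k, j)) \<in> {..<n} \<rightarrow> carrier (corner R e)"
          using entry xy ij C.m_closed by (auto simp: \<phi>_def)
      qed simp
      finally show ?thesis .
    qed
    then show "\<phi> (x \<otimes> y) = \<phi> x \<otimes>\<^bsub>?M\<^esub> \<phi> y"
      by (auto simp: matrix_ring_def \<phi>_def restrict_def fun_eq_iff)
    show "\<phi> (x \<oplus> y) = \<phi> x \<oplus>\<^bsub>?M\<^esub> \<phi> y"
      using xy by (auto simp: matrix_ring_def \<phi>_def restrict_def fun_eq_iff l_distr r_distr)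
  next
    show "\<phi> \<one> = \<one>\<^bsub>?M\<^esub>"
      by (auto simp: matrix_ring_def \<phi>_def restrict_def fun_eq_iff pq)
  next
    show "bij_betw \<phi> (carrier R) (carrier ?M)"
      unfolding bij_betw_def
    proof
      have recover: "(\<Oplus>k\<in>{..<n}. \<Oplus>l\<in>{..<n}. q k \<otimes> \<phi> x (k, l) \<otimes> p l) = x" if x: "x \<in> carrier R" for x
      proof -
        have "x = (\<Oplus>k\<in>{..<n}. q k \<otimes> (p k \<otimes> x))"
        proof -
          have "(\<Oplus>k\<in>{..<n}. q k \<otimes> (p k \<otimes> x)) = (\<Oplus>k\<in>{..<n}. (\<one> \<otimes> q k) \<otimes> (p k \<otimes> x))"
            using x by (intro finsum_cong') auto
          then show ?thesis
            using expand[of \<one> x] x by simp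
        qed
        also have "\<dots> = (\<Oplus>k\<in>{..<n}. \<Oplus>l\<in>{..<n}. q k \<otimes> \<phi> x (k, l) \<otimes> p l)"
        proof (rule finsum_cong')
          fix k assume k: "k \<in> {..<n}"
          have "q k \<otimes> (p k \<otimes> x) = (\<Oplus>l\<in>{..<n}. (q k \<otimes> (p k \<otimes> x) \<otimes> q l) \<otimes> (p l \<otimes> \<one>))"
            using k x by (simp add: expand)
          also have "\<dots> = (\<Oplus>l\<in>{..<n}. q k \<otimes> \<phi> x (k, l) \<otimes> p l)"
            using k x by (intro finsum_cong') (auto simp: \<phi>_def m_assoc)
          finally show "q k \<otimes> (p k \<otimes> x) = (\<Oplus>l\<in>{..<n}. q k \<otimes> \<phi> x (k, l) \<otimes> p l)" .
        qed (use x in \<open>auto intro!: finsum_closed simp: \<phi>_def\<close>)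
        finally show ?thesis by (rule sym)
      qed
      show "inj_on \<phi> (carrier R)"
        using recover
        by (rule inj_on_inverseI[where g = "\<lambda>A. \<Oplus>k\<in>{..<n}. \<Oplus>l\<in>{..<n}. q k \<otimes> A (k, l) \<otimes> p l"])
      show "\<phi> ` carrier R = carrier ?M"
      proof (intro equalityI subsetI)
        fix A assume A: "A \<in> carrier ?M"
        then have "A (i, j) \<in> carrier (corner R e)" if "i < n" "j < n" for i j
          using that by (auto simp: matrix_ring_def)
        then have Ac [simp]: "A (i, j) \<in> carrier R" "e \<otimes> A (i, j) = A (i, j)" "A (i, j) \<otimes> e = A (i, j)"
          if "i < n" "j < n" for i j
          using that by (auto simp: carrier_corner)
        define x where "x = (\<Oplus>k\<in>{..<n}. \<Oplus>l\<in>{..<n}. q k \<otimes> A (k, l) \<otimes> p l)"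
        have x: "x \<in> carrier R"
          unfolding x_def by (intro finsum_closed) auto
        \<comment> \<open>By \<open>pq\<close> only the summand k = i, l = j survives, and it equals
          \<open>e \<otimes> A (i, j) \<otimes> e\<close>, which is the entry itself.\<close>
        have "p i \<otimes> x \<otimes> q j = A (i, j)" if ij: "i < n" "j < n" for i j
        proof -
          have 1: "p i \<otimes> (q k \<otimes> A (k, l) \<otimes> p l) \<otimes> q j = (p i \<otimes> q k) \<otimes> A (k, l) \<otimes> (p l \<otimes> q j)"
            if "k < n" "l < n" for k l
            using ij that by (simp add: m_assoc)
          have "p i \<otimes> x \<otimes> q j = (\<Oplus>k\<in>{..<n}. \<Oplus>l\<in>{..<n}. p i \<otimes> (q k \<otimes> A (k, l) \<otimes> p l) \<otimes> q j)"
          proof -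
            have sandwich: "p i \<otimes> finsum R g {..<n} \<otimes> q j = (\<Oplus>k\<in>{..<n}. p i \<otimes> g k \<otimes> q j)"
              if "g \<in> {..<n} \<rightarrow> carrier R" for g
              using that ij by (subst finsum_rdistr, auto, subst finsum_ldistr, auto simp: Pi_def)
            have "p i \<otimes> x \<otimes> q j =
                (\<Oplus>k\<in>{..<n}. p i \<otimes> (\<Oplus>l\<in>{..<n}. q k \<otimes> A (k, l) \<otimes> p l) \<otimes> q j)"
              unfolding x_def by (rule sandwich) (auto intro!: finsum_closed)
            also have "\<dots> = (\<Oplus>k\<in>{..<n}. \<Oplus>l\<in>{..<n}. p i \<otimes> (q k \<otimes> A (k, l) \<otimes> p l) \<otimes> q j)"
              using ij by (intro finsum_cong' sandwich) (auto intro!: finsum_closed)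
            finally show ?thesis .
          qed
          also have "\<dots> = (\<Oplus>l\<in>{..<n}. p i \<otimes> (q i \<otimes> A (i, l) \<otimes> p l) \<otimes> q j)"
            using ij e by (intro finsum_delta) (auto simp: 1 pq intro!: finsum_closed add.finprod_one_eqI)
          also have "\<dots> = p i \<otimes> (q i \<otimes> A (i, j) \<otimes> p j) \<otimes> q j"
            using ij e by (intro finsum_delta) (auto simp: 1 pq)
          also have "\<dots> = A (i, j)"
            using ij by (simp add: 1 pq)
          finally show ?thesis .
        qed
        then have "\<phi> x = A"
          using A by (auto simp: \<phi>_def matrix_ring_def fun_eq_iff restrict_def PiE_def extensional_def)
        with x show "A \<in> \<phi> ` carrier R"
          by blast
      qed (use \<phi>_closed in auto)
    qed
  qed (use \<phi>_closed in auto)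
  then show ?thesis
    by (auto simp: is_ring_iso_def)
qed

section \<open>From Property K to matrices\<close>

text \<open>Cancels opposite terms with one summand between them, as occurs after sums have been
  sorted by \<open>a_ac\<close>; used as rewrite rules for the noncommutative expansions
  below.\<close>

lemma add_cancel_left_neg:
  assumes "x \<in> carrier R" "y \<in> carrier R" "z \<in> carrier R"
  shows "x \<oplus> (y \<oplus> \<ominus> x) = y" "x \<oplus> (y \<oplus> (\<ominus> x \<oplus> z)) = y \<oplus> z"
  using assms by (metis a_assoc a_comm a_inv_closed a_closed r_neg2)+

text \<open>If w inverts ab = ba, then wb is a left inverse and bw a right inverse of a, so the two
  coincide.\<close>

lemma commuting_unit_factors:
  assumes "a \<in> carrier R" "b \<in> carrier R" "a \<otimes> b = b \<otimes> a" "a \<otimes> b \<in> Units R"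
  shows "a \<in> Units R"
proof -
  let ?w = "inv (a \<otimes> b)"
  have w: "?w \<in> carrier R" "a \<otimes> b \<otimes> ?w = \<one>" "?w \<otimes> (a \<otimes> b) = \<one>"
    using assms by auto
  have l: "(?w \<otimes> b) \<otimes> a = \<one>" and r: "a \<otimes> (b \<otimes> ?w) = \<one>"
    using assms(1,2) w by (simp_all add: m_assoc flip: assms(3))
  have "?w \<otimes> b = b \<otimes> ?w"
    using inv_unique[OF l r] assms w by simp
  moreover have "b \<otimes> ?w \<in> carrier R"
    using assms w by simp
  ultimately show ?thesis
    using assms(1) l r unfolding Units_def by auto
qed

lemma property_K_imp_matrix_ring:
  assumes "property_K R"
  shows "\<exists>S :: 'a ring. ring S \<and> R \<simeq> matrix_ring 2 S \<and> \<one>\<^bsub>S\<^esub> \<in> Units S <+>\<^bsub>S\<^esub> Units S"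
proof -
  obtain e e' where e: "e \<in> carrier R" "e \<otimes> e = e" and e': "e' \<in> carrier R" "e' \<otimes> e' = e'"
    and U: "e \<otimes> e' \<ominus> e' \<otimes> e \<in> Units R"
    using assms by (auto simp: property_K_def)
  have ee: "e \<otimes> (e \<otimes> x) = e \<otimes> x" "e' \<otimes> (e' \<otimes> x) = e' \<otimes> x" if "x \<in> carrier R" for x
    using that e e' by (simp_all add: m_assoc[symmetric])
  define c where "c = e \<otimes> e' \<ominus> e' \<otimes> e"
  define d where "d = inv c"
  define f where "f = \<one> \<ominus> e"
  have c: "c \<in> carrier R" and d: "d \<in> carrier R" and f: "f \<in> carrier R"
    using U e e' by (auto simp: c_def d_def f_def)
  have cd: "c \<otimes> d = \<one>" "d \<otimes> c = \<one>"
    using U by (auto simp: c_def d_def)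
  \<comment> \<open>Both sides of the first equation expand to ee' - ee'e, those of the second to
    ee'e - e'e. Thus c interchanges e and its complement f.\<close>
  have ec: "e \<otimes> c = c \<otimes> f" and fc: "f \<otimes> c = c \<otimes> e"
    using e e' by (simp_all add: c_def f_def minus_eq l_distr r_distr l_minus r_minus m_assoc ee
        minus_add a_ac r_neg r_neg1 r_neg2 add_cancel_left_neg)
  have ef: "e \<otimes> f = \<zero>" "f \<otimes> e = \<zero>" and ef1: "e \<oplus> f = \<one>"
    using e by (simp_all add: f_def minus_eq l_distr r_distr l_minus r_minus r_neg add_cancel_left_neg)
  \<comment> \<open>Multiply fc = ce by d on both sides.\<close>
  have ed: "e \<otimes> d = d \<otimes> f"
  proof -
    have "e \<otimes> d = d \<otimes> (c \<otimes> e) \<otimes> d"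
      using e c d cd by (simp add: m_assoc[symmetric])
    also have "\<dots> = d \<otimes> f \<otimes> (c \<otimes> d)"
      using e c d f by (simp add: fc[symmetric] m_assoc)
    finally show ?thesis
      using d f cd by simp
  qed
  have dec: "d \<otimes> (e \<otimes> c) = f"
    using c d f cd by (simp add: ec m_assoc[symmetric])
  let ?S = "corner R e"
  interpret S: ring ?S
    using e by (rule ring_corner)
  have two: "{..<2::nat} = {0, 1}"
    by auto
  \<comment> \<open>Take p = (e, ec) and q = (e, de). The mixed products vanish because c and d move
    e past itself into f, and fe = 0; the sum of the \<open>q k \<otimes> p k\<close> is e + dec = e
    + f = 1.\<close>
  have "R \<simeq> matrix_ring 2 ?S"
  proof (rule iso_matrix_ring_corner[where p = "\<lambda>i. if i = 0 then e else e \<otimes> c"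
        and q = "\<lambda>i. if i = 0 then e else d \<otimes> e"])
    have "e \<otimes> (d \<otimes> e) = \<zero>"
      using e d f by (simp add: m_assoc[symmetric] ed) (simp add: m_assoc ef)
    moreover have "e \<otimes> c \<otimes> e = \<zero>"
      using e c f by (simp add: ec) (simp add: m_assoc ef)
    moreover have "e \<otimes> c \<otimes> (d \<otimes> e) = e"
    proof -
      have "e \<otimes> c \<otimes> (d \<otimes> e) = e \<otimes> (c \<otimes> d) \<otimes> e"
        using e c d by (simp add: m_assoc)
      then show ?thesis
        using e cd by simp
    qed
    ultimately show "(if i = 0 then e else e \<otimes> c) \<otimes> (if j = 0 then e else d \<otimes> e) =
        (if i = j then e else \<zero>)" if "i < 2" "j < 2" for i j :: nat
      using that e by (auto simp: less_2_cases_iff)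
    have "d \<otimes> e \<otimes> (e \<otimes> c) = f"
      using e c d dec by (simp add: m_assoc ee)
    then show "(\<Oplus>k\<in>{..<2::nat}. (if k = 0 then e else d \<otimes> e) \<otimes> (if k = 0 then e else e \<otimes> c)) = \<one>"
      using e c d f ef1 by (simp add: two)
  qed (use e c d in \<open>auto simp: m_assoc ee\<close>)
  moreover have "\<one>\<^bsub>?S\<^esub> \<in> Units ?S <+>\<^bsub>?S\<^esub> Units ?S"
  proof -
    \<comment> \<open>The summands a and b are the compressions of e' and 1 - e' to the corner, so
      they add up to e.\<close>
    define a where "a = e \<otimes> e' \<otimes> e"
    define b where "b = e \<ominus> a"
    have a: "a \<in> carrier R" "e \<otimes> a = a" "a \<otimes> e = a"
      using e e' by (simp_all add: a_def m_assoc ee)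
    have b: "b \<in> carrier R" "e \<otimes> b = b" "b \<otimes> e = b"
      using a e by (simp_all add: b_def minus_eq l_distr r_distr l_minus r_minus)
    have aS: "a \<in> carrier ?S" and bS: "b \<in> carrier ?S"
      using a b by (simp_all add: carrier_corner)
    have comm: "a \<otimes> b = b \<otimes> a"
      using a e by (simp add: b_def minus_eq l_distr r_distr l_minus r_minus)
    \<comment> \<open>Since c swaps e and f, its square commutes with e; the same holds for
      d.\<close>
    have ecc: "e \<otimes> (c \<otimes> c) = c \<otimes> c \<otimes> e"
      using e c f by (simp add: m_assoc[symmetric] ec) (simp add: m_assoc fc)
    have edd: "e \<otimes> (d \<otimes> d) = d \<otimes> d \<otimes> e"
    proof -
      have "f \<otimes> d = d \<otimes> e"
        using ed e d by (simp add: f_def minus_eq l_distr r_distr l_minus r_minus minus_add minus_minus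
            a_lcomm r_neg r_neg2)
      then show ?thesis
        using e d f by (simp add: m_assoc[symmetric] ed) (simp add: m_assoc)
    qed
    \<comment> \<open>Both sides equal ee'e - ee'ee'e.\<close>
    have ab: "a \<otimes> b = \<ominus> (e \<otimes> (c \<otimes> c))"
      using e e' by (simp add: a_def b_def c_def minus_eq l_distr r_distr l_minus r_minus m_assoc ee
        minus_add a_ac r_neg r_neg1 r_neg2 add_cancel_left_neg)
    have ccdd: "c \<otimes> (c \<otimes> (d \<otimes> d)) = \<one>" "d \<otimes> (d \<otimes> (c \<otimes> c)) = \<one>"
      using c d cd by (metis m_assoc m_closed l_one)+
    have "a \<otimes> b \<in> Units ?S"
    proof -
      \<comment> \<open>The squares of c and d are mutually inverse and commute with e, so
        multiplying each by e gives mutually inverse elements of the corner; the sign comes from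
        \<open>ab\<close>.\<close>
      let ?w = "\<ominus> (e \<otimes> (d \<otimes> d))"
      have "?w \<in> carrier ?S"
        using e d by (simp add: carrier_corner l_minus r_minus ee) (simp add: edd m_assoc e)
      moreover have "(a \<otimes> b) \<otimes> ?w = e"
      proof -
        have "(a \<otimes> b) \<otimes> ?w = (c \<otimes> c \<otimes> e) \<otimes> (e \<otimes> (d \<otimes> d))"
          using e c d by (simp add: ab l_minus r_minus ecc)
        also have "\<dots> = e \<otimes> (c \<otimes> (c \<otimes> (d \<otimes> d)))"
          using e c d by (simp add: m_assoc ee) (simp add: m_assoc[symmetric] ecc[symmetric])
        finally show ?thesis
          using e by (simp add: ccdd)
      qed
      moreover have "?w \<otimes> (a \<otimes> b) = e"
      proof -
        have "?w \<otimes> (a \<otimes> b) = (d \<otimes> d \<otimes> e) \<otimes> (e \<otimes> (c \<otimes> c))"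
          using e c d by (simp add: ab l_minus r_minus edd)
        also have "\<dots> = e \<otimes> (d \<otimes> (d \<otimes> (c \<otimes> c)))"
          using e c d by (simp add: m_assoc ee) (simp add: m_assoc[symmetric] edd[symmetric])
        finally show ?thesis
          using e by (simp add: ccdd)
      qed
      ultimately show ?thesis
        using S.m_closed[OF aS bS] by (auto simp: Units_def)
    qed
    then have "a \<in> Units ?S" "b \<in> Units ?S"
      using S.commuting_unit_factors[of a b] S.commuting_unit_factors[of b a] aS bS comm by auto
    moreover have "e = a \<oplus> b"
      using a e by (simp add: b_def minus_eq add_cancel_left_neg)
    ultimately show ?thesis
      by (auto simp: set_add_def set_mult_def)
  qed
  ultimately show ?thesis
    using S.ring_axioms by blast
qed

end

section \<open>From matrices to Property K\<close>

text \<open>Entries are listed row by row. The restriction to the index set makes the function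
  extensional, as membership in the carrier of \<open>matrix_ring\<close> demands.\<close>

definition mat2 :: "'a \<Rightarrow> 'a \<Rightarrow> 'a \<Rightarrow> 'a \<Rightarrow> nat \<times> nat \<Rightarrow> 'a" where
  "mat2 a b c d = (\<lambda>(i, j) \<in> {..<2} \<times> {..<2}.
     if i = 0 then (if j = 0 then a else b) else (if j = 0 then c else d))"

context ring
begin

lemma mat2_closed:
  "\<lbrakk>a \<in> carrier R; b \<in> carrier R; c \<in> carrier R; d \<in> carrier R\<rbrakk>
    \<Longrightarrow> mat2 a b c d \<in> carrier (matrix_ring 2 R)"
  by (auto simp: mat2_def matrix_ring_def)

lemma mat2_one: "\<one>\<^bsub>matrix_ring 2 R\<^esub> = mat2 \<one> \<zero> \<zero> \<one>"
  by (auto simp: mat2_def matrix_ring_def restrict_def fun_eq_iff less_2_cases_iff)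

lemma mat2_add:
  "mat2 a b c d \<oplus>\<^bsub>matrix_ring 2 R\<^esub> mat2 a' b' c' d' = mat2 (a \<oplus> a') (b \<oplus> b') (c \<oplus> c') (d \<oplus> d')"
  by (auto simp: mat2_def matrix_ring_def restrict_def fun_eq_iff)

lemma mat2_mult:
  assumes "a \<in> carrier R" "b \<in> carrier R" "c \<in> carrier R" "d \<in> carrier R"
    and "a' \<in> carrier R" "b' \<in> carrier R" "c' \<in> carrier R" "d' \<in> carrier R"
  shows "mat2 a b c d \<otimes>\<^bsub>matrix_ring 2 R\<^esub> mat2 a' b' c' d' =
    mat2 (a \<otimes> a' \<oplus> b \<otimes> c') (a \<otimes> b' \<oplus> b \<otimes> d') (c \<otimes> a' \<oplus> d \<otimes> c') (c \<otimes> b' \<oplus> d \<otimes> d')"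
proof -
  have two: "{..<2::nat} = {0, 1}"
    by auto
  show ?thesis
    using assms by (auto simp: mat2_def matrix_ring_def restrict_def fun_eq_iff two)
qed

end

text \<open>The explicit matrices are pulled back along the isomorphism h. Each identity in R is
  then checked on its image under h, entry by entry in S, and returned by injectivity.\<close>

lemma matrix_ring_imp_property_K:
  assumes "ring R" "ring S" "R \<simeq> matrix_ring 2 S" "\<one>\<^bsub>S\<^esub> \<in> Units S <+>\<^bsub>S\<^esub> Units S"
  shows "property_K R"
proof -
  interpret R: ring R by fact
  interpret S: ring S by fact
  let ?M = "matrix_ring 2 S"
  obtain h where h: "h \<in> ring_iso R ?M"
    using assms(3) by (auto simp: is_ring_iso_def)
  then have hom: "\<And>x y. x \<in> carrier R \<Longrightarrow> y \<in> carrier R \<Longrightarrow> h (x \<otimes>\<^bsub>R\<^esub> y) = h x \<otimes>\<^bsub>?M\<^esub> h y"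
      "\<And>x y. x \<in> carrier R \<Longrightarrow> y \<in> carrier R \<Longrightarrow> h (x \<oplus>\<^bsub>R\<^esub> y) = h x \<oplus>\<^bsub>?M\<^esub> h y"
      "h \<one>\<^bsub>R\<^esub> = \<one>\<^bsub>?M\<^esub>"
    by (auto simp: ring_iso_def ring_hom_def)
  have inj: "inj_on h (carrier R)" and surj: "h ` carrier R = carrier ?M"
    using h by (auto simp: ring_iso_def bij_betw_def)
  have pre: "\<exists>x\<in>carrier R. h x = mat2 a b c d"
    if "a \<in> carrier S" "b \<in> carrier S" "c \<in> carrier S" "d \<in> carrier S" for a b c d
    using S.mat2_closed[OF that] surj by (metis imageE)
  obtain u v where u: "u \<in> Units S" and v: "v \<in> Units S" and uv: "u \<oplus>\<^bsub>S\<^esub> v = \<one>\<^bsub>S\<^esub>"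
    using assms(4) by (auto simp: set_add_def set_mult_def)
  have uc: "u \<in> carrier S" and vc: "v \<in> carrier S"
    using u v by auto
  \<comment> \<open>Factor out u and v on the left and use u + v = 1; these are the entries of the
    square of (u, u; v, v).\<close>
  have absorb: "u \<otimes>\<^bsub>S\<^esub> u \<oplus>\<^bsub>S\<^esub> u \<otimes>\<^bsub>S\<^esub> v = u" "v \<otimes>\<^bsub>S\<^esub> u \<oplus>\<^bsub>S\<^esub> v \<otimes>\<^bsub>S\<^esub> v = v"
    using uc vc by (simp_all add: S.r_distr[symmetric] uv)
  obtain e where e: "e \<in> carrier R" "h e = mat2 \<one>\<^bsub>S\<^esub> \<zero>\<^bsub>S\<^esub> \<zero>\<^bsub>S\<^esub> \<zero>\<^bsub>S\<^esub>"
    using pre[OF S.one_closed S.zero_closed S.zero_closed S.zero_closed] by blast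
  obtain e' where e': "e' \<in> carrier R" "h e' = mat2 u u v v"
    using pre[OF uc uc vc vc] by blast
  \<comment> \<open>Here c is the preimage of the expected commutator, and d below is the preimage
    of the inverse matrix.\<close>
  obtain c where c: "c \<in> carrier R" "h c = mat2 \<zero>\<^bsub>S\<^esub> u (\<ominus>\<^bsub>S\<^esub> v) \<zero>\<^bsub>S\<^esub>"
    using pre[OF S.zero_closed uc S.a_inv_closed[OF vc] S.zero_closed] by blast
  obtain d where d: "d \<in> carrier R" "h d = mat2 \<zero>\<^bsub>S\<^esub> (\<ominus>\<^bsub>S\<^esub> (inv\<^bsub>S\<^esub> v)) (inv\<^bsub>S\<^esub> u) \<zero>\<^bsub>S\<^esub>"
    using pre[OF S.zero_closed S.a_inv_closed[OF S.Units_inv_closed[OF v]]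
        S.Units_inv_closed[OF u] S.zero_closed] by blast
  have "e \<otimes>\<^bsub>R\<^esub> e = e"
    by (rule inj_onD[OF inj]) (simp_all add: hom e S.mat2_mult)
  moreover have "e' \<otimes>\<^bsub>R\<^esub> e' = e'"
    by (rule inj_onD[OF inj]) (simp_all add: hom e' S.mat2_mult uc vc absorb)
  moreover have "e \<otimes>\<^bsub>R\<^esub> e' \<ominus>\<^bsub>R\<^esub> e' \<otimes>\<^bsub>R\<^esub> e \<in> Units R"
  proof -
    \<comment> \<open>The commutator identity is stated with a sum because \<open>hom\<close>
      transports sums and products; the subtraction is carried out afterwards in R.\<close>
    have "e \<otimes>\<^bsub>R\<^esub> e' = c \<oplus>\<^bsub>R\<^esub> e' \<otimes>\<^bsub>R\<^esub> e"
      by (rule inj_onD[OF inj])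
        (simp_all add: hom e e' c S.mat2_mult S.mat2_add uc vc S.l_neg)
    then have "e \<otimes>\<^bsub>R\<^esub> e' \<ominus>\<^bsub>R\<^esub> e' \<otimes>\<^bsub>R\<^esub> e = c"
      using e e' c by (simp add: R.minus_eq R.a_assoc R.r_neg)
    moreover have "c \<otimes>\<^bsub>R\<^esub> d = \<one>\<^bsub>R\<^esub>"
      by (rule inj_onD[OF inj])
        (simp_all add: hom c d S.mat2_mult S.mat2_one u v uc vc S.l_minus S.r_minus)
    moreover have "d \<otimes>\<^bsub>R\<^esub> c = \<one>\<^bsub>R\<^esub>"
      by (rule inj_onD[OF inj])
        (simp_all add: hom c d S.mat2_mult S.mat2_one u v uc vc S.l_minus S.r_minus)
    ultimately show ?thesis
      using c d by (auto simp: Units_def)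
  qed
  ultimately show ?thesis
    using e e' unfolding property_K_def by blast
qed

text \<open>An existential in HOL cannot range over types. The corner has the element type of R, so
  the equivalence can be stated with S over \<open>'a\<close>; the second conjunct gives the
  converse for S over an arbitrary type.\<close>

theorem theoremB:
  fixes R :: "('a, 'm) ring_scheme"
  assumes "ring R"
  shows "(property_K R \<longleftrightarrow>
           (\<exists>S :: 'a ring. ring S \<and> R \<simeq> matrix_ring 2 S \<and>
              \<one>\<^bsub>S\<^esub> \<in> Units S <+>\<^bsub>S\<^esub> Units S)) \<and>
         (\<forall>S :: ('b, 'n) ring_scheme. ring S \<and> R \<simeq> matrix_ring 2 S \<and>
              \<one>\<^bsub>S\<^esub> \<in> Units S <+>\<^bsub>S\<^esub> Units S \<longrightarrow> property_K R)"
  by (intro conjI iffI allI impI)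
    (blast intro: ring.property_K_imp_matrix_ring[OF assms] matrix_ring_imp_property_K[OF assms])+

end
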